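(* Assume that the $H$ action on $X$ satisfies an effective mean ergodic theorem with exponent $\kappa$. Let $\{A_t\}_{t\ge1}$ be a decreasing family of measurable subsets of $X$ with $\mu(A_t)\asymp 1/t$. Then for all $\eta<2\kappa d_H^-$ and for almost every $x\in X$, for all sufficiently large $T$ there is $h\in H_T$ with $xh\in A_{T^\eta}$.
   Context: Notation: $F(t)\ll G(t)$ means $F(t)\le cG(t)$ for some constant $c>0$ (subscripts indicate what $c$ depends on), and $F(t)\asymp G(t)$ means $c^{-1}F(t)\le G(t)\le cF(t)$ for some constant $c>1$. $H$ is a group acting ergodically on a probability space $(X,\mu)$; the action is written on the right, $x\mapsto xh$, and leads to a unitary representation of $H$ on $L^2(X)$. $m$ denotes Haar measure on $H$. A norm $\|\cdot\|$ on $H$ is fixed and $H_t=\{h\in H:\|h\|\le t\}$. Growth exponents: $d_H^-\le d_H^+$ are such that for any $\epsilon>0$, $t^{d_H^--\epsilon}\ll_\epsilon m(H_t)\ll_\epsilon t^{d_H^++\epsilon}$. Effective mean ergodic theorem with exponent $\kappa>0$: for $f\in L^2(X)$ put $\pi_t(f)(x)=\frac{1}{m(H_t)}\int_{H_t}f(xh)\,dm(h)$; the condition is that for any $f\in L^2(X)$, $\|\pi_t f-\int_X f\,d\mu\|_2\ll_\kappa m(H_t)^{-\kappa}\|f\|_2$. *)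

theory Defs
  imports "HOL-Probability.Probability" "HOL-Algebra.Group"
begin

text \<open>Locally compact Hausdorff groups, with the topology carried by the carrier set.\<close>

locale lc_group = group G for G :: "('h, 'b) monoid_scheme" (structure) +
  fixes T :: "'h topology"
  assumes topspace_eq: "topspace T = carrier G"
    and continuous_mult:
      "continuous_map (prod_topology T T) T (\<lambda>(g, h). g \<otimes>\<^bsub>G\<^esub> h)"
    and continuous_inv: "continuous_map T T (\<lambda>g. inv\<^bsub>G\<^esub> g)"
    and hausdorff: "Hausdorff_space T"
    and locally_compact: "locally_compact_space T"

definition borel_of :: "'h topology \<Rightarrow> 'h measure" where
  "borel_of T = sigma (topspace T) {U. openin T U}"

text \<open>A nonzero Radon measure on the Borel sets, invariant under left translations or under
  right translations. Both sides are allowed, because no convention is imposed on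
  non-unimodular groups.\<close>

definition haar_measure ::
  "('h, 'b) monoid_scheme \<Rightarrow> 'h topology \<Rightarrow> 'h measure \<Rightarrow> bool" where
  "haar_measure G T m \<longleftrightarrow>
     sets m = sets (borel_of T) \<and>
     emeasure m (carrier G) \<noteq> 0 \<and>
     (\<forall>K. compactin T K \<longrightarrow> emeasure m K < \<infinity>) \<and>
     (\<forall>B\<in>sets m. emeasure m B = (INF U\<in>{U. openin T U \<and> B \<subseteq> U}. emeasure m U)) \<and>
     (\<forall>U. openin T U \<longrightarrow>
        emeasure m U = (SUP K\<in>{K. compactin T K \<and> K \<subseteq> U}. emeasure m K)) \<and>
     ((\<forall>g\<in>carrier G. \<forall>B\<in>sets m. emeasure m ((\<lambda>h. g \<otimes>\<^bsub>G\<^esub> h) ` B) = emeasure m B) \<or>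
      (\<forall>g\<in>carrier G. \<forall>B\<in>sets m. emeasure m ((\<lambda>h. h \<otimes>\<^bsub>G\<^esub> g) ` B) = emeasure m B))"

text \<open>The last condition is implied both by the triangle inequality for a length function
  on the group and by submultiplicativity up to a constant. The latter holds for the
  restriction of any vector space norm on matrices to a matrix group.\<close>

definition norm_on_group ::
  "('h, 'b) monoid_scheme \<Rightarrow> 'h topology \<Rightarrow> ('h \<Rightarrow> real) \<Rightarrow> bool" where
  "norm_on_group G T N \<longleftrightarrow>
     N \<in> borel_measurable (borel_of T) \<and>
     (\<forall>h\<in>carrier G. 0 \<le> N h) \<and>
     (\<exists>C. \<forall>g\<in>carrier G. \<forall>h\<in>carrier G. N (g \<otimes>\<^bsub>G\<^esub> h) \<le> C * (1 + N g) * (1 + N h))"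

definition norm_ball ::
  "('h, 'b) monoid_scheme \<Rightarrow> ('h \<Rightarrow> real) \<Rightarrow> real \<Rightarrow> 'h set" where
  "norm_ball G N t = {h \<in> carrier G. N h \<le> t}"

text \<open>Here \<open>act x h\<close> stands for \<open>xh\<close>; the action preserves the probability measure and
  is jointly measurable.\<close>

locale pmp_right_action = lc_group G T + prob_space M
  for G :: "('h, 'b) monoid_scheme" (structure) and T :: "'h topology"
    and M :: "'x measure" +
  fixes act :: "'x \<Rightarrow> 'h \<Rightarrow> 'x"
  assumes act_one: "x \<in> space M \<Longrightarrow> act x \<one>\<^bsub>G\<^esub> = x"
    and act_mult: "\<lbrakk>x \<in> space M; g \<in> carrier G; h \<in> carrier G\<rbrakk> \<Longrightarrow>
      act (act x g) h = act x (g \<otimes>\<^bsub>G\<^esub> h)"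
    and act_measurable: "(\<lambda>(x, h). act x h) \<in> M \<Otimes>\<^sub>M borel_of T \<rightarrow>\<^sub>M M"
    and act_preserving: "h \<in> carrier G \<Longrightarrow> distr M M (\<lambda>x. act x h) = M"

definition ergodic_right_action ::
  "('h, 'b) monoid_scheme \<Rightarrow> 'x measure \<Rightarrow> ('x \<Rightarrow> 'h \<Rightarrow> 'x) \<Rightarrow> bool" where
  "ergodic_right_action G M act \<longleftrightarrow>
     (\<forall>B\<in>sets M. (\<forall>h\<in>carrier G. (\<lambda>x. act x h) ` B = B) \<longrightarrow>
        measure M B = 0 \<or> measure M B = 1)"

text \<open>The implied constants may depend on \<open>\<epsilon>\<close>, and the bounds are asymptotic in \<open>t\<close>.
  The lower bound forces the balls of large radius, and hence all balls, to have finite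
  measure, since \<open>measure\<close> returns \<open>0\<close> on sets of infinite measure.\<close>

definition growth_exponents ::
  "('h, 'b) monoid_scheme \<Rightarrow> 'h measure \<Rightarrow> ('h \<Rightarrow> real) \<Rightarrow> real \<Rightarrow> real \<Rightarrow> bool" where
  "growth_exponents G m N dminus dplus \<longleftrightarrow>
     dminus \<le> dplus \<and>
     (\<forall>\<epsilon>>0.
        (\<lambda>t. t powr (dminus - \<epsilon>)) \<in> O[at_top](\<lambda>t. measure m (norm_ball G N t)) \<and>
        (\<lambda>t. measure m (norm_ball G N t)) \<in> O[at_top](\<lambda>t. t powr (dplus + \<epsilon>)))"

definition L2_fun :: "'x measure \<Rightarrow> ('x \<Rightarrow> complex) \<Rightarrow> bool" where
  "L2_fun M f \<longleftrightarrow> f \<in> borel_measurable M \<and> integrable M (\<lambda>x. (cmod (f x))\<^sup>2)"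

definition L2_norm :: "'x measure \<Rightarrow> ('x \<Rightarrow> complex) \<Rightarrow> real" where
  "L2_norm M f = sqrt (\<integral>x. (cmod (f x))\<^sup>2 \<partial>M)"

definition ball_average ::
  "('h, 'b) monoid_scheme \<Rightarrow> 'h measure \<Rightarrow> ('h \<Rightarrow> real) \<Rightarrow> ('x \<Rightarrow> 'h \<Rightarrow> 'x) \<Rightarrow>
   real \<Rightarrow> ('x \<Rightarrow> complex) \<Rightarrow> 'x \<Rightarrow> complex" where
  "ball_average G m N act t f x =
     (1 / measure m (norm_ball G N t)) *\<^sub>R
       set_lebesgue_integral m (norm_ball G N t) (\<lambda>h. f (act x h))"

text \<open>The constant is uniform in \<open>f\<close> and \<open>t\<close>. Radii whose ball has measure zero are
  excluded, because the average is undefined there.\<close>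

definition effective_mean_ergodic ::
  "('h, 'b) monoid_scheme \<Rightarrow> 'h measure \<Rightarrow> ('h \<Rightarrow> real) \<Rightarrow> 'x measure \<Rightarrow>
   ('x \<Rightarrow> 'h \<Rightarrow> 'x) \<Rightarrow> real \<Rightarrow> bool" where
  "effective_mean_ergodic G m N M act \<kappa> \<longleftrightarrow>
     0 < \<kappa> \<and>
     (\<exists>c>0. \<forall>f. L2_fun M f \<longrightarrow>
        (\<forall>t. 0 < measure m (norm_ball G N t) \<longrightarrow>
           L2_norm M (\<lambda>x. ball_average G m N act t f x - (\<integral>y. f y \<partial>M))
             \<le> c * measure m (norm_ball G N t) powr (- \<kappa>) * L2_norm M f))"

end

theory Submission
  imports Defs
begin

text \<open>If no point of \<open>x H\<^sub>t\<close> lies in \<open>E\<close>, then the average over \<open>H\<^sub>t\<close> of the indicator of \<open>E\<close>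
  vanishes at \<open>x\<close> and so differs from its mean by \<open>\<mu>(E)\<close>. The effective mean ergodic theorem and
  Chebyshev's inequality bound the measure of such \<open>x\<close> by a multiple of
  \<open>m(H\<^sub>t)\<^sup>-\<^sup>2\<^sup>\<kappa> / \<mu>(E)\<close>. For \<open>t = 2\<^sup>k\<close> and \<open>E = A\<close> at \<open>(2\<^sup>k\<^sup>+\<^sup>1)\<^sup>\<eta>\<close> these bounds decay geometrically, so
  Borel--Cantelli applies along powers of two; the shift from \<open>k\<close> to \<open>k + 1\<close> lets monotonicity of
  balls and targets handle the radii in between.\<close>

lemma norm_ball_mono: "s \<le> t \<Longrightarrow> norm_ball G N s \<subseteq> norm_ball G N t"
  by (auto simp: norm_ball_def)

text \<open>Used in contrapositive form: a nonzero average at \<open>x\<close> yields some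
  \<open>h\<close> in the ball with \<open>act x h\<close> in \<open>E\<close>. The integrand
  vanishes identically, so this holds at each individual \<open>x\<close>.\<close>

lemma ball_average_indicator_eq_0:
  assumes "\<And>h. h \<in> norm_ball G N t \<Longrightarrow> act x h \<notin> E"
  shows "ball_average G m N act t (indicator E) x = 0"
proof -
  have "(\<lambda>h. indicator (norm_ball G N t) h *\<^sub>R (indicator E (act x h) :: complex)) = (\<lambda>h. 0)"
    using assms by (auto simp: indicator_def)
  then show ?thesis
    by (simp only: ball_average_def set_lebesgue_integral_def) simp
qed

lemma norm_ball_average_indicator_le_1:
  assumes "0 < measure m (norm_ball G N t)"
  shows "cmod (ball_average G m N act t (indicator E) x) \<le> 1"
proof -
  let ?B = "norm_ball G N t"
  \<comment> \<open>\<open>measure\<close> returns 0 on sets of infinite measure and on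
    nonmeasurable sets, so positivity gives both finiteness and measurability of the ball.\<close>
  have fin: "emeasure m ?B < \<infinity>"
    using assms by (cases "emeasure m ?B = \<infinity>") (auto simp: measure_def less_top)
  have sets: "?B \<in> sets m"
    using assms by (metis measure_notin_sets less_irrefl)
  have "cmod (set_lebesgue_integral m ?B (\<lambda>h. indicator E (act x h)))
      \<le> (\<integral>h. indicator ?B h \<partial>m)"
    unfolding set_lebesgue_integral_def
    by (rule order_trans[OF integral_norm_bound integral_mono'[OF integrable_real_indicator]])
      (use fin sets in \<open>auto simp: indicator_def\<close>)
  also have "\<dots> = measure m ?B"
    using sets by simp
  finally show ?thesis
    using assms by (simp add: ball_average_def divide_simps)
qed

context pmp_right_action
begin

lemma norm_ball_sets:
  assumes "sets m = sets (borel_of T)" "N \<in> borel_measurable (borel_of T)"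
  shows "norm_ball G N t \<in> sets m"
proof -
  have "space (borel_of T) = carrier G"
    by (simp add: borel_of_def topspace_eq space_measure_of_conv)
  then have "norm_ball G N t = {h \<in> space (borel_of T). N h \<le> t}"
    by (simp add: norm_ball_def)
  also have "\<dots> \<in> sets (borel_of T)"
    using assms(2) by measurable
  finally show ?thesis
    using assms(1) by simp
qed

text \<open>Measurability in \<open>x\<close> is the Fubini-type statement for integrals with a
  parameter. It asks for a sigma-finite measure, and Haar measure may fail to be one; so
  \<open>m\<close> is restricted to the ball, where it is finite.\<close>

lemma ball_average_measurable:
  assumes m: "sets m = sets (borel_of T)" and N: "N \<in> borel_measurable (borel_of T)"
    and V: "0 < measure m (norm_ball G N t)"
    and f: "f \<in> borel_measurable M"
  shows "ball_average G m N act t f \<in> borel_measurable M"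
proof -
  let ?B = "norm_ball G N t"
  define R where "R = restrict_space m ?B"
  have B: "?B \<in> sets m"
    by (rule norm_ball_sets[OF m N])
  have "emeasure m ?B \<noteq> \<infinity>"
    using V by (auto simp: measure_def)
  then interpret R: finite_measure R
    using B by (intro finite_measureI)
      (simp add: R_def space_restrict_space emeasure_restrict_space sets.sets_into_space Int_absorb2)
  have "(\<lambda>(x, h). act x h) \<in> M \<Otimes>\<^sub>M m \<rightarrow>\<^sub>M M"
    using act_measurable by (simp cong: measurable_cong_sets add: sets_pair_measure_cong[OF refl m])
  \<comment> \<open>The identity, read as a map from the restricted product to the full one, carries
    the joint measurability of the action over to \<open>R\<close>.\<close>
  moreover have "(\<lambda>p. (fst p, snd p)) \<in> M \<Otimes>\<^sub>M R \<rightarrow>\<^sub>M M \<Otimes>\<^sub>M m"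
    unfolding R_def
    by (intro measurable_Pair measurable_fst measurable_compose[OF measurable_snd]
      measurable_restrict_space1 measurable_ident_sets refl)
  ultimately have "(\<lambda>(x, h). act x h) \<in> M \<Otimes>\<^sub>M R \<rightarrow>\<^sub>M M"
    by (auto simp: split_beta' dest: measurable_compose)
  then have "(\<lambda>(x, h). f (act x h)) \<in> borel_measurable (M \<Otimes>\<^sub>M R)"
    using f by (auto simp: split_beta' dest: measurable_compose)
  then have "(\<lambda>x. \<integral>h. f (act x h) \<partial>R) \<in> borel_measurable M"
    by (rule R.borel_measurable_lebesgue_integral)
  moreover have "set_lebesgue_integral m ?B (\<lambda>h. f (act x h)) = (\<integral>h. f (act x h) \<partial>R)" for x
    using B by (simp add: R_def integral_restrict_space set_lebesgue_integral_def)
  ultimately show ?thesis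
    unfolding ball_average_def by simp
qed

text \<open>Here \<open>b\<close> is the ergodic error rate at one fixed radius. On the zero set the
  error has modulus \<open>measure M E\<close>, while the squared norm of the indicator is also
  \<open>measure M E\<close>; one of the two factors in the Chebyshev denominator therefore
  cancels.\<close>

lemma measure_ball_average_eq_0_le:
  assumes m: "sets m = sets (borel_of T)" and N: "N \<in> borel_measurable (borel_of T)"
    and V: "0 < measure m (norm_ball G N t)"
    and E: "E \<in> sets M" "0 < measure M E"
    and met: "\<And>f. L2_fun M f \<Longrightarrow>
      L2_norm M (\<lambda>x. ball_average G m N act t f x - (\<integral>y. f y \<partial>M)) \<le> b * L2_norm M f"
  shows "measure M {x \<in> space M. ball_average G m N act t (indicator E) x = 0} \<le> b\<^sup>2 / measure M E"
proof -
  let ?f = "indicator E :: 'x \<Rightarrow> complex"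
  let ?D = "\<lambda>x. ball_average G m N act t ?f x - (\<integral>y. ?f y \<partial>M)"
  let ?Z = "{x \<in> space M. ball_average G m N act t ?f x = 0}"
  have cmod_f: "(\<lambda>x. (cmod (?f x))\<^sup>2) = indicator E"
    by (auto simp: indicator_def)
  have mean: "(\<integral>y. ?f y \<partial>M) = of_real (measure M E)"
  proof -
    have "?f = (\<lambda>y. complex_of_real (indicator E y))"
      by (auto simp: indicator_def)
    then show ?thesis
      using E by (simp only: integral_complex_of_real integral_indicator) simp
  qed
  have L2: "L2_fun M ?f"
    using E by (simp add: L2_fun_def cmod_f integrable_real_indicator emeasure_eq_measure)
  have norm_f: "(L2_norm M ?f)\<^sup>2 = measure M E"
    using E by (simp add: L2_norm_def cmod_f)
  have avg: "ball_average G m N act t ?f \<in> borel_measurable M"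
    using E by (intro ball_average_measurable[OF m N V]) auto
  have Z: "?Z \<in> sets M"
    using avg by measurable
  have D: "?D \<in> borel_measurable M"
    using avg by measurable
  \<comment> \<open>Boundedness makes the squared error integrable. Otherwise \<open>L2_norm\<close>
    could be the default value 0 and its bound would carry no information.\<close>
  have "cmod (?D x) \<le> 2" for x
  proof -
    have "cmod (?D x) \<le> cmod (ball_average G m N act t ?f x) + cmod (\<integral>y. ?f y \<partial>M)"
      by (rule norm_triangle_ineq4)
    also have "\<dots> \<le> 1 + 1"
      using norm_ball_average_indicator_le_1[OF V] by (intro add_mono) (auto simp: mean)
    finally show ?thesis by simp
  qed
  then have "(cmod (?D x))\<^sup>2 \<le> 2\<^sup>2" for x
    by (intro power_mono) auto
  then have int: "integrable M (\<lambda>x. (cmod (?D x))\<^sup>2)"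
    using D by (intro integrable_const_bound[where B = "2\<^sup>2"]) auto
  have "measure M ?Z * (measure M E)\<^sup>2 = (\<integral>x. indicator ?Z x * (measure M E)\<^sup>2 \<partial>M)"
    using Z by simp
  also have "\<dots> \<le> (\<integral>x. (cmod (?D x))\<^sup>2 \<partial>M)"
  proof (rule integral_mono'[OF int])
    show "indicator ?Z x * (measure M E)\<^sup>2 \<le> (cmod (?D x))\<^sup>2" for x
      by (cases "x \<in> ?Z") (auto simp: mean)
  qed simp
  also have "\<dots> = (L2_norm M ?D)\<^sup>2"
    by (simp add: L2_norm_def)
  also have "\<dots> \<le> (b * L2_norm M ?f)\<^sup>2"
    by (intro power_mono met[OF L2]) (simp add: L2_norm_def)
  also have "\<dots> = b\<^sup>2 * measure M E"
    by (simp add: power_mult_distrib norm_f)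
  finally show ?thesis
    using E(2) by (simp add: power2_eq_square field_simps)
qed

end

theorem proposition2p3:
  fixes G :: "('h, 'b) monoid_scheme" and T :: "'h topology"
    and m :: "'h measure" and N :: "'h \<Rightarrow> real"
    and M :: "'x measure" and act :: "'x \<Rightarrow> 'h \<Rightarrow> 'x"
    and dminus dplus \<kappa> \<eta> :: real
    and A :: "real \<Rightarrow> 'x set"
  assumes action: "pmp_right_action G T M act"
    and ergodic: "ergodic_right_action G M act"
    and haar: "haar_measure G T m"
    and norm: "norm_on_group G T N"
    and growth: "growth_exponents G m N dminus dplus"
    and met: "effective_mean_ergodic G m N M act \<kappa>"
    and A_sets: "\<And>t. 1 \<le> t \<Longrightarrow> A t \<in> sets M"
    and A_decreasing: "\<And>s t. 1 \<le> s \<Longrightarrow> s \<le> t \<Longrightarrow> A t \<subseteq> A s"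
    and A_measure: "\<exists>c>1. \<forall>t\<ge>1. measure M (A t) / c \<le> 1 / t \<and> 1 / t \<le> c * measure M (A t)"
    and \<eta>_nonneg: "0 \<le> \<eta>"
    and \<eta>_less: "\<eta> < 2 * \<kappa> * dminus"
  shows "AE x in M. \<forall>\<^sub>F R in at_top. \<exists>h\<in>norm_ball G N R. act x h \<in> A (R powr \<eta>)"
proof -
  interpret pmp_right_action G T M act
    by (rule action)
  have m: "sets m = sets (borel_of T)"
    using haar by (simp add: haar_measure_def)
  have N: "N \<in> borel_measurable (borel_of T)"
    using norm by (simp add: norm_on_group_def)
  define V where "V t = measure m (norm_ball G N t)" for t
  from met obtain c where \<kappa>: "0 < \<kappa>" and c: "0 < c" and met_c:
    "\<And>f t. L2_fun M f \<Longrightarrow> 0 < V t \<Longrightarrow>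
       L2_norm M (\<lambda>x. ball_average G m N act t f x - (\<integral>y. f y \<partial>M))
         \<le> c * V t powr (- \<kappa>) * L2_norm M f"
    unfolding effective_mean_ergodic_def V_def by blast
  from A_measure obtain a where a: "1 < a" and A_le: "\<And>t. 1 \<le> t \<Longrightarrow> 1 / t \<le> a * measure M (A t)"
    by blast
  \<comment> \<open>\<open>\<delta>\<close> is half the available gap. The loss
    \<open>\<delta> / (2 * \<kappa>)\<close> in the growth exponent uses up only half of that gap,
    leaving decay of order \<open>\<delta>\<close> after the factor of order \<open>\<eta>\<close>
    from the shrinking targets.\<close>
  define \<delta> where "\<delta> = (2 * \<kappa> * dminus - \<eta>) / 2"
  define e where "e = dminus - \<delta> / (2 * \<kappa>)"
  have \<delta>: "0 < \<delta>"
    using \<eta>_less by (simp add: \<delta>_def)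
  have e: "2 * \<kappa> * e = \<eta> + \<delta>"
    using \<kappa> by (simp add: e_def \<delta>_def field_simps)
  have "(\<lambda>t. t powr e) \<in> O(V)"
    using growth \<delta> \<kappa> unfolding growth_exponents_def e_def V_def by simp
  then obtain d where d: "0 < d" and "\<forall>\<^sub>F t in at_top. norm (t powr e) \<le> d * norm (V t)"
    by (elim landau_o.bigE)
  then have "\<forall>\<^sub>F t in at_top. t powr e \<le> d * V t"
    by (simp add: V_def)
  then obtain t0 where growth_d: "\<And>t. t0 \<le> t \<Longrightarrow> t powr e \<le> d * V t"
    unfolding eventually_at_top_linorder by blast

  define r where "r k = (2::real) ^ k" for k
  have r_ge_1: "1 \<le> r k" for k
    by (simp add: r_def)
  define E where "E k = A (r (Suc k) powr \<eta>)" for k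
  \<comment> \<open>The family \<open>A\<close> is controlled only at parameters at least 1.\<close>
  have radius: "1 \<le> r k powr \<eta>" for k
    using \<eta>_nonneg r_ge_1 by (simp add: ge_one_powr_ge_zero)
  have E: "E k \<in> sets M" for k
    unfolding E_def by (intro A_sets radius)
  have E_ge: "1 / measure M (E k) \<le> a * r (Suc k) powr \<eta>" and E_pos: "0 < measure M (E k)" for k
  proof -
    have *: "1 / r (Suc k) powr \<eta> \<le> a * measure M (E k)"
      unfolding E_def by (intro A_le radius)
    moreover have "0 < 1 / r (Suc k) powr \<eta>"
      using r_ge_1[of "Suc k"] by auto
    ultimately have "0 < a * measure M (E k)"
      by linarith
    then show "0 < measure M (E k)"
      using a by (simp add: zero_less_mult_iff)
    then show "1 / measure M (E k) \<le> a * r (Suc k) powr \<eta>"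
      using * r_ge_1[of "Suc k"] by (simp add: divide_le_eq mult_ac split: if_splits)
  qed
  define Z where "Z k = {x \<in> space M. ball_average G m N act (r k) (indicator (E k)) x = 0}" for k
  \<comment> \<open>The factors come from the ergodic theorem, the volume growth, the size of the
    targets, and \<open>r (Suc k) = 2 * r k\<close>, in this order.\<close>
  define K where "K = c\<^sup>2 * d powr (2 * \<kappa>) * a * 2 powr \<eta>"
  \<comment> \<open>Both claims rest on \<open>0 < V (r k)\<close>, which the growth bound provides
    from \<open>t0\<close> on.\<close>
  have Z_bound: "Z k \<in> sets M \<and> measure M (Z k) \<le> K * (2 powr (- \<delta>)) ^ k" if k: "t0 \<le> r k" for k
  proof
    have r: "0 < r k" "r k powr e \<le> d * V (r k)"
      using r_ge_1[of k] growth_d[OF k] by auto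
    then have "0 < d * V (r k)"
      by (metis order_less_le_trans powr_gt_zero less_numeral_extra(3))
    then have V: "0 < V (r k)"
      using d by (simp add: zero_less_mult_iff)
    have "ball_average G m N act (r k) (indicator (E k)) \<in> borel_measurable M"
      using V E by (intro ball_average_measurable[OF m N]) (auto simp: V_def)
    then show "Z k \<in> sets M"
      unfolding Z_def by measurable
    have "V (r k) powr (- \<kappa>) * V (r k) powr (- \<kappa>) = V (r k) powr (- (2 * \<kappa>))"
      by (simp flip: powr_add)
    \<comment> \<open>The exponent is negative, so the lower bound on the volume turns into an upper
      bound.\<close>
    also have "\<dots> \<le> (r k powr e / d) powr (- (2 * \<kappa>))"
      using r d \<kappa> by (intro powr_mono2') (auto simp: field_simps)
    also have "\<dots> = d powr (2 * \<kappa>) * r k powr (- (2 * \<kappa> * e))"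
      using r(1) d by (simp add: powr_divide powr_powr powr_minus field_simps)
    finally have V_le: "(V (r k) powr (- \<kappa>))\<^sup>2 \<le> d powr (2 * \<kappa>) * r k powr (- (\<eta> + \<delta>))"
      by (simp add: power2_eq_square e)
    have "measure M (Z k) \<le> (c * V (r k) powr (- \<kappa>))\<^sup>2 / measure M (E k)"
      unfolding Z_def using V met_c[OF _ V]
      by (intro measure_ball_average_eq_0_le[OF m N _ E E_pos]) (auto simp: V_def)
    also have "\<dots> = c\<^sup>2 * (V (r k) powr (- \<kappa>))\<^sup>2 * (1 / measure M (E k))"
      by (simp add: power_mult_distrib)
    also have "\<dots> \<le> c\<^sup>2 * (d powr (2 * \<kappa>) * r k powr (- (\<eta> + \<delta>))) * (a * r (Suc k) powr \<eta>)"
      using V_le E_ge[of k] by (intro mult_mono) auto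
    also have "\<dots> = K * (r k powr (- (\<eta> + \<delta>)) * r k powr \<eta>)"
      using r(1) by (simp add: K_def r_def powr_mult)
    also have "r k powr (- (\<eta> + \<delta>)) * r k powr \<eta> = r k powr (- \<delta>)"
      by (simp flip: powr_add)
    also have "\<dots> = (2 powr (- \<delta>)) ^ k"
      by (simp add: r_def powr_powr mult.commute flip: powr_realpow)
    finally show "measure M (Z k) \<le> K * (2 powr (- \<delta>)) ^ k" .
  qed

  \<comment> \<open>Borel-Cantelli is applied to the sequence shifted by \<open>k0\<close>, so that
    every set in it satisfies \<open>Z_bound\<close>.\<close>
  obtain k0 where "t0 < 2 ^ k0"
    using real_arch_pow[of 2 t0] by auto
  then have large: "t0 \<le> r (k + k0)" for k
    using power_increasing[of k0 "k + k0" "2::real"] unfolding r_def by linarith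
  have "AE x in M. \<forall>\<^sub>F k in sequentially. x \<in> space M - Z (k + k0)"
  proof (rule borel_cantelli_AE1)
    have "(2::real) powr (- \<delta>) < 1"
      using \<delta> powr_less_mono[of "- \<delta>" 0 2] by simp
    then have "summable (\<lambda>k. K * (2 powr (- \<delta>)) ^ k)"
      by (intro summable_mult summable_geometric) simp
    then have "summable (\<lambda>k. K * (2 powr (- \<delta>)) ^ (k + k0))"
      by (subst summable_iff_shift)
    then show "summable (\<lambda>k. measure M (Z (k + k0)))"
      by (rule summable_comparison_test') (use Z_bound[OF large] in auto)
  qed (use Z_bound[OF large] in \<open>auto simp: emeasure_eq_measure\<close>)
  then show ?thesis
  proof eventually_elim
    case (elim x)
    then obtain k1 where k1: "\<And>k. k1 \<le> k \<Longrightarrow> x \<in> space M - Z (k + k0)"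
      unfolding eventually_sequentially by blast
    show "\<forall>\<^sub>F R in at_top. \<exists>h\<in>norm_ball G N R. act x h \<in> A (R powr \<eta>)"
      using eventually_ge_at_top[of "r (k1 + k0)"]
    proof eventually_elim
      case (elim R)
      then have R: "1 \<le> R"
        using r_ge_1 order_trans by blast
      \<comment> \<open>The least index whose radius exceeds \<open>R\<close> is positive because
        \<open>r 0 = 1 \<le> R\<close>; its predecessor is the wanted \<open>k\<close>.\<close>
      obtain n where "R < r n"
        using real_arch_pow[of 2 R] by (auto simp: r_def)
      moreover have "\<not> R < r 0"
        using R by (simp add: r_def)
      ultimately obtain k where k: "r k \<le> R" "R < r (Suc k)"
        using ex_least_nat_less[of "\<lambda>n. R < r n" n] by (meson order_refl not_less)
      have "r (k1 + k0) < r (Suc k)"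
        using elim k by simp
      then have "k1 + k0 \<le> k"
        by (simp add: r_def less_Suc_eq_le del: power_Suc)
      \<comment> \<open>Since \<open>k0 \<le> k\<close>, the subtraction \<open>k - k0\<close> is
        exact, and it is at least \<open>k1\<close>.\<close>
      then have "x \<in> space M - Z k"
        using k1[of "k - k0"] by simp
      then have "ball_average G m N act (r k) (indicator (E k)) x \<noteq> 0"
        by (simp add: Z_def)
      then obtain h where h: "h \<in> norm_ball G N (r k)" "act x h \<in> E k"
        using ball_average_indicator_eq_0[of G N "r k" act x "E k" m] by metis
      have "1 \<le> R powr \<eta>" "R powr \<eta> \<le> r (Suc k) powr \<eta>"
        using R k \<eta>_nonneg by (simp_all add: ge_one_powr_ge_zero powr_mono2)
      then have "E k \<subseteq> A (R powr \<eta>)"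
        unfolding E_def by (rule A_decreasing)
      then show ?case
        using h norm_ball_mono[OF k(1), of G N] by (intro bexI[of _ h]) auto
    qed
  qed
qed

end
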